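(* Let $F$ be a field and let $A$ be a finitely presented associative $F$-algebra with an idempotent $e$ such that $A=AeA=A(1-e)A$. Then the Peirce component $eAe$ is finitely presented.
   Context: Algebras are associative over the field $F$ and are not assumed to have an identity element. $AeA$ denotes the $F$-linear span of all products $aeb$ with $a,b\in A$, and $A(1-e)A$ denotes the $F$-linear span of all elements $a(1-e)b=ab-aeb$ with $a,b\in A$; the symbol $1$ is used formally, so that these expressions make sense whether or not $A$ has an identity element. The Peirce component is the subalgebra $eAe=\{eae : a\in A\}$ of $A$. An associative $F$-algebra $B$ generated by a finite collection of elements $b_1,\dots,b_m$ is called finitely presented if the kernel of the homomorphism $F\langle x_1,\dots,x_m\rangle\to B$, $x_i\mapsto b_i$, from the free associative algebra on $x_1,\dots,x_m$ is finitely generated as a (two-sided) ideal. This property does not depend on the choice of the finite generating system of $B$. *)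

theory Defs
  imports Complex_Main "HOL-Library.Poly_Mapping"
begin

section \<open>Associative algebras over a field, not necessarily with an identity\<close>

text \<open>The class \<^class>\<open>ring\<close> is that of associative rings without a required identity.\<close>

definition peirce :: "'a::ring \<Rightarrow> 'a set" where
  "peirce e = {e * a * e | a. True}"

locale assoc_algebra = vector_space scale
  for scale :: "'f::field \<Rightarrow> 'a::ring \<Rightarrow> 'a" (infixr \<open>*s\<close> 75) +
  assumes scale_mult_left: "(c *s x) * y = c *s (x * y)"
    and scale_mult_right: "x * (c *s y) = c *s (x * y)"
begin

definition subalgebra :: "'a set \<Rightarrow> bool" where
  "subalgebra B \<longleftrightarrow> subspace B \<and> (\<forall>x\<in>B. \<forall>y\<in>B. x * y \<in> B)"

definition ideal_of :: "'a set \<Rightarrow> 'a set \<Rightarrow> bool" where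
  "ideal_of B I \<longleftrightarrow> subspace I \<and> I \<subseteq> B \<and> (\<forall>b\<in>B. \<forall>x\<in>I. b * x \<in> I \<and> x * b \<in> I)"

definition finitely_generated_ideal :: "'a set \<Rightarrow> 'a set \<Rightarrow> bool" where
  "finitely_generated_ideal B I \<longleftrightarrow> (\<exists>R. finite R \<and> R \<subseteq> B \<and> ideal_of B hull R = I)"

lemma subalgebra_UNIV: "subalgebra UNIV"
  by (simp add: subalgebra_def)

lemma subalgebra_peirce:
  assumes "e * e = e"
  shows "subalgebra (peirce e)"
proof -
  have "subspace (peirce e)"
  proof (rule subspaceI)
    show "0 \<in> peirce e"
      unfolding peirce_def by (auto intro!: exI[of _ 0])
  next
    fix x y assume "x \<in> peirce e" "y \<in> peirce e"
    then obtain a b where "x = e * a * e" "y = e * b * e"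
      unfolding peirce_def by blast
    then have "x + y = e * (a + b) * e"
      by (simp add: distrib_left distrib_right)
    then show "x + y \<in> peirce e"
      unfolding peirce_def by blast
  next
    fix c x assume "x \<in> peirce e"
    then obtain a where "x = e * a * e"
      unfolding peirce_def by blast
    then have "c *s x = e * (c *s a) * e"
      by (simp add: scale_mult_left scale_mult_right)
    then show "c *s x \<in> peirce e"
      unfolding peirce_def by blast
  qed
  moreover have "x * y \<in> peirce e" if "x \<in> peirce e" "y \<in> peirce e" for x y
  proof -
    from that obtain a b where "x = e * a * e" "y = e * b * e"
      unfolding peirce_def by blast
    then have "x * y = e * (a * e * e * b) * e"
      by (simp add: mult.assoc)
    then show ?thesis
      unfolding peirce_def by blast
  qed
  ultimately show ?thesis
    by (simp add: subalgebra_def)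
qed

end


section \<open>Free associative algebras\<close>

text \<open>
  Finitely supported functions on a monoid form the monoid algebra in
  \<^theory>\<open>HOL-Library.Poly_Mapping\<close>; its monoid is written additively, so concatenation of words
  in the variables \<open>x\<^sub>0, x\<^sub>1, \<dots>\<close> is \<open>+\<close> here.
\<close>

datatype free_word = Word (letters: "nat list")

instantiation free_word :: monoid_add
begin

definition "0 = Word []"

definition "u + v = Word (letters u @ letters v)"

instance
  by standard (auto simp: zero_free_word_def plus_free_word_def)

end

lemma letters_zero [simp]: "letters 0 = []"
  by (simp add: zero_free_word_def)

lemma letters_plus [simp]: "letters (u + v) = letters u @ letters v"
  by (simp add: plus_free_word_def)

definition free_scale :: "'f::field \<Rightarrow> (free_word \<Rightarrow>\<^sub>0 'f) \<Rightarrow> (free_word \<Rightarrow>\<^sub>0 'f)" where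
  "free_scale c p = Poly_Mapping.map ((*) c) p"

lemma lookup_free_scale [simp]: "Poly_Mapping.lookup (free_scale c p) w = c * Poly_Mapping.lookup p w"
  by (simp add: free_scale_def map.rep_eq when_def)

lemma sum_monomials:
  "(\<Sum>w\<in>Poly_Mapping.keys p. Poly_Mapping.single w (Poly_Mapping.lookup p w)) = p"
  by (rule poly_mapping_eqI) (auto simp: lookup_sum lookup_single when_def in_keys_iff)

lemma single_zero_commute: "p * Poly_Mapping.single 0 c = Poly_Mapping.single 0 c * p"
  for p :: "free_word \<Rightarrow>\<^sub>0 'f::field"
proof -
  let ?q = "\<Sum>w\<in>Poly_Mapping.keys p. Poly_Mapping.single w (Poly_Mapping.lookup p w)"
  have "?q * Poly_Mapping.single 0 c = Poly_Mapping.single 0 c * ?q"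
    by (simp only: sum_distrib_left sum_distrib_right mult_single add_0_left add_0_right
        mult.commute[of c])
  then show ?thesis
    by (simp only: sum_monomials)
qed

interpretation free: assoc_algebra "free_scale :: 'f::field \<Rightarrow> _"
proof
  fix c d :: 'f and p q :: "free_word \<Rightarrow>\<^sub>0 'f"
  show "free_scale c (p + q) = free_scale c p + free_scale c q"
    by (rule poly_mapping_eqI) (simp add: lookup_add distrib_left)
  show "free_scale (c + d) p = free_scale c p + free_scale d p"
    by (rule poly_mapping_eqI) (simp add: lookup_add distrib_right)
  show "free_scale c (free_scale d p) = free_scale (c * d) p"
    by (rule poly_mapping_eqI) simp
  show "free_scale 1 p = p"
    by (rule poly_mapping_eqI) simp
  show "free_scale c p * q = free_scale c (p * q)"
    by (simp add: free_scale_def mult_map_scale_conv_mult mult.assoc)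
  show "p * free_scale c q = free_scale c (p * q)"
    unfolding free_scale_def mult_map_scale_conv_mult
    by (metis mult.assoc single_zero_commute)
qed

text \<open>
  The free algebra on \<open>x\<^sub>0, \<dots>, x\<^sub>m\<^sub>-\<^sub>1\<close> in the category of algebras without identity: its
  elements have zero constant term.
\<close>

definition free_algebra :: "nat \<Rightarrow> (free_word \<Rightarrow>\<^sub>0 'f::field) set" where
  "free_algebra m = {p. \<forall>w\<in>Poly_Mapping.keys p. letters w \<noteq> [] \<and> set (letters w) \<subseteq> {..<m}}"

lemma subalgebra_free_algebra: "free.subalgebra (free_algebra m :: (free_word \<Rightarrow>\<^sub>0 'f::field) set)"
proof -
  have "free.subspace (free_algebra m :: (free_word \<Rightarrow>\<^sub>0 'f) set)"
  proof (rule free.subspaceI)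
    show "(0 :: free_word \<Rightarrow>\<^sub>0 'f) \<in> free_algebra m"
      by (simp add: free_algebra_def)
    show "p + q \<in> free_algebra m" if "p \<in> free_algebra m" "q \<in> free_algebra m"
      for p q :: "free_word \<Rightarrow>\<^sub>0 'f"
      using that keys_add[of p q] unfolding free_algebra_def by blast
    show "free_scale c p \<in> free_algebra m" if "p \<in> free_algebra m" for c and p :: "free_word \<Rightarrow>\<^sub>0 'f"
      using that by (auto simp: free_algebra_def in_keys_iff)
  qed
  moreover have "p * q \<in> free_algebra m" if "p \<in> free_algebra m" "q \<in> free_algebra m"
    for p q :: "free_word \<Rightarrow>\<^sub>0 'f"
  proof -
    have "letters w \<noteq> [] \<and> set (letters w) \<subseteq> {..<m}" if w: "w \<in> Poly_Mapping.keys (p * q)" for w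
    proof -
      obtain u v where "w = u + v" "u \<in> Poly_Mapping.keys p" "v \<in> Poly_Mapping.keys q"
        using w keys_mult[of p q] by auto
      with \<open>p \<in> free_algebra m\<close> \<open>q \<in> free_algebra m\<close> show ?thesis
        by (auto simp: free_algebra_def)
    qed
    then show ?thesis
      by (simp add: free_algebra_def)
  qed
  ultimately show ?thesis
    by (simp add: free.subalgebra_def)
qed


section \<open>Finite presentation\<close>

text \<open>The value at \<open>[]\<close> is irrelevant: the empty word does not occur in \<^const>\<open>free_algebra\<close>.\<close>

fun list_product :: "'a::ring list \<Rightarrow> 'a" where
  "list_product [] = 0"
| "list_product [x] = x"
| "list_product (x # y # zs) = x * list_product (y # zs)"

lemma list_product_append:
  "xs \<noteq> [] \<Longrightarrow> ys \<noteq> [] \<Longrightarrow> list_product (xs @ ys) = list_product xs * list_product ys"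
proof (induction xs rule: list_product.induct)
  case 1
  then show ?case by simp
next
  case (2 x)
  then obtain y zs where "ys = y # zs"
    by (cases ys) auto
  then show ?case by simp
next
  case (3 x y zs)
  then show ?case by (simp add: mult.assoc)
qed

context assoc_algebra
begin

definition free_eval :: "(nat \<Rightarrow> 'a) \<Rightarrow> (free_word \<Rightarrow>\<^sub>0 'f) \<Rightarrow> 'a" where
  "free_eval b p = (\<Sum>w\<in>Poly_Mapping.keys p. Poly_Mapping.lookup p w *s list_product (map b (letters w)))"

definition finitely_presented :: "'a set \<Rightarrow> bool" where
  "finitely_presented B \<longleftrightarrow>
    (\<exists>m b. subalgebra hull (b ` {..<m}) = B \<and>
      free.finitely_generated_ideal (free_algebra m) {p \<in> free_algebra m. free_eval b p = 0})"

text \<open>The map \<^const>\<open>free_eval\<close> is the homomorphism with \<open>x\<^sub>i \<mapsto> b\<^sub>i\<close>.\<close>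

lemma free_eval_superset:
  assumes "finite S" "Poly_Mapping.keys p \<subseteq> S"
  shows "free_eval b p = (\<Sum>w\<in>S. Poly_Mapping.lookup p w *s list_product (map b (letters w)))"
  unfolding free_eval_def
  by (rule sum.mono_neutral_left) (use assms in \<open>auto simp: in_keys_iff\<close>)

lemma free_eval_single [simp]:
  "free_eval b (Poly_Mapping.single w c) = c *s list_product (map b (letters w))"
  by (cases "c = 0") (simp_all add: free_eval_def)

lemma free_eval_variable: "free_eval b (Poly_Mapping.single (Word [i]) 1) = b i"
  by simp

lemma free_eval_add: "free_eval b (p + q) = free_eval b p + free_eval b q"
proof -
  let ?S = "Poly_Mapping.keys p \<union> Poly_Mapping.keys q"
  have "Poly_Mapping.keys (p + q) \<subseteq> ?S"
    by (rule keys_add)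
  then show ?thesis
    by (simp add: free_eval_superset[of ?S] lookup_add scale_left_distrib sum.distrib)
qed

lemma free_eval_scale: "free_eval b (free_scale c p) = c *s free_eval b p"
proof -
  have "Poly_Mapping.keys (free_scale c p) \<subseteq> Poly_Mapping.keys p"
    by (auto simp: in_keys_iff)
  then show ?thesis
    by (simp add: free_eval_superset[of "Poly_Mapping.keys p"] scale_sum_right)
qed

lemma free_eval_sum: "free_eval b (sum f S) = (\<Sum>x\<in>S. free_eval b (f x))"
proof (induction S rule: infinite_finite_induct)
  case (insert x S)
  then show ?case by (simp add: free_eval_add)
qed (simp_all add: free_eval_def)

lemma free_eval_mult:
  assumes "p \<in> free_algebra m" "q \<in> free_algebra m"
  shows "free_eval b (p * q) = free_eval b p * free_eval b q"
proof -
  have "free_eval b (p * q) =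
    free_eval b ((\<Sum>u\<in>Poly_Mapping.keys p. Poly_Mapping.single u (Poly_Mapping.lookup p u)) *
      (\<Sum>v\<in>Poly_Mapping.keys q. Poly_Mapping.single v (Poly_Mapping.lookup q v)))"
    by (simp only: sum_monomials)
  also have "\<dots> = (\<Sum>u\<in>Poly_Mapping.keys p. \<Sum>v\<in>Poly_Mapping.keys q.
      (Poly_Mapping.lookup p u * Poly_Mapping.lookup q v) *s list_product (map b (letters u @ letters v)))"
    by (simp add: sum_product mult_single free_eval_sum)
  also have "\<dots> = (\<Sum>u\<in>Poly_Mapping.keys p. \<Sum>v\<in>Poly_Mapping.keys q.
      (Poly_Mapping.lookup p u *s list_product (map b (letters u))) *
      (Poly_Mapping.lookup q v *s list_product (map b (letters v))))"
    using assms
    by (intro sum.cong refl)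
      (simp add: free_algebra_def list_product_append scale_mult_left scale_mult_right)
  also have "\<dots> = free_eval b p * free_eval b q"
    by (simp add: free_eval_def sum_product)
  finally show ?thesis .
qed

end

end

theory Submission
  imports Defs
begin

text \<open>
  Let \<open>x\<^sub>0, \<dots>, x\<^sub>m\<^sub>-\<^sub>1\<close> generate \<open>A\<close>, with finitely many defining relations \<open>R\<close>.  Since
  \<open>A = AeA\<close>, there are \<open>p\<^sub>0, \<dots>, p\<^sub>n\<^sub>-\<^sub>1\<close> in \<open>Ae\<close> and \<open>q\<^sub>0, \<dots>, q\<^sub>n\<^sub>-\<^sub>1\<close> in \<open>eA\<close> such that every \<open>x\<^sub>k\<close> is
  a sum of products \<open>p\<^sub>i q\<^sub>i\<close>, for \<open>i\<close> in an index set \<open>I k\<close>; one may take \<open>p\<^sub>0 = q\<^sub>0 = e\<close>.  A word in the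
  generators, placed between \<open>q\<^sub>s\<close> and \<open>p\<^sub>t\<close>, regroups into a polynomial in the elements
  \<open>y\<^sub>s\<^sub>t = q\<^sub>s p\<^sub>t\<close> of \<open>eAe\<close>.  With \<open>s = t = 0\<close> this shows that the \<open>y\<^sub>s\<^sub>t\<close> generate \<open>eAe\<close>.

  The regrouping makes sense formally: it is a linear map \<open>sandwich s t\<close> from the free algebra in
  the \<open>x\<^sub>k\<close> to the free algebra in the \<open>y\<^sub>s\<^sub>t\<close>.  It is not multiplicative, but satisfies
  \<open>sandwich s t (f x\<^sub>k g) = \<Sum>\<^sub>i sandwich s i f \<cdot> sandwich i t g\<close>, the sum being over \<open>I k\<close>.
  Choose polynomials \<open>right u\<close> and \<open>left v\<close> in the \<open>x\<^sub>k\<close> with values \<open>q\<^sub>u\<close> and \<open>p\<^sub>v\<close>.  The relations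
    \<^item> \<open>y\<^sub>0\<^sub>0 y\<^sub>s\<^sub>t = y\<^sub>s\<^sub>t = y\<^sub>s\<^sub>t y\<^sub>0\<^sub>0\<close>,
    \<^item> \<open>sandwich s t r = 0\<close> for \<open>r\<close> in \<open>R\<close>,
    \<^item> \<open>sandwich s t (right u) = y\<^sub>s\<^sub>0 y\<^sub>u\<^sub>t\<close> and \<open>sandwich s t (left v) = y\<^sub>s\<^sub>v y\<^sub>0\<^sub>t\<close>
  hold in \<open>eAe\<close> and are finite in number.  They define \<open>eAe\<close>.  Indeed, let \<open>f\<close> be a polynomial in
  the \<open>y\<^sub>s\<^sub>t\<close> that vanishes in \<open>eAe\<close>, and substitute \<open>right s \<cdot> left t\<close> for \<open>y\<^sub>s\<^sub>t\<close>.  The result vanishes in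
  \<open>A\<close>, hence lies in the ideal generated by \<open>R\<close>, and its sandwich for \<open>s = t = 0\<close> is a consequence
  of the relations (\<open>sandwich_preserves_ideal\<close>).  But modulo the relations this sandwich is
  \<open>f\<close> itself (\<open>sandwich_substitute\<close>).

  Behind the formulas is the Morita context formed by \<open>Ae\<close> and \<open>eA\<close>: the matrices \<open>X\<close> over the algebra
  presented by these relations, with product \<open>X \<circ> X' = X Y X'\<close> for the matrix \<open>Y\<close> of the \<open>y\<^sub>s\<^sub>t\<close>,
  receive a homomorphism from \<open>A\<close> after division by the ideal of those \<open>X\<close> with \<open>Y X Y = 0\<close>; the
  sandwiches of an element of \<open>A\<close> are the entries of \<open>Y X Y\<close> for its image \<open>X\<close>.
\<close>


section \<open>Polynomials without constant term\<close>

lemma poly_mapping_additive_induct: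
  fixes p :: "'a \<Rightarrow>\<^sub>0 'b::comm_monoid_add"
  assumes zero: "P 0"
    and add: "\<And>p q. P p \<Longrightarrow> P q \<Longrightarrow> P (p + q)"
    and single: "\<And>w c. w \<in> Poly_Mapping.keys p \<Longrightarrow> P (Poly_Mapping.single w c)"
  shows "P p"
proof -
  have "P (\<Sum>w\<in>S. Poly_Mapping.single w (Poly_Mapping.lookup p w))"
    if "finite S" "S \<subseteq> Poly_Mapping.keys p" for S
    using that by (induction S rule: finite_induct) (auto intro: assms)
  moreover have "(\<Sum>w\<in>Poly_Mapping.keys p. Poly_Mapping.single w (Poly_Mapping.lookup p w)) = p"
    by (rule poly_mapping_eqI) (auto simp: lookup_sum lookup_single when_def in_keys_iff)
  ultimately show ?thesis
    by (metis finite_keys order_refl)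
qed

lemma free_algebra_induct [consumes 1, case_names zero add monomial]:
  fixes p :: "free_word \<Rightarrow>\<^sub>0 'f::field"
  assumes "p \<in> free_algebra m"
    and "P 0"
    and "\<And>p q. P p \<Longrightarrow> P q \<Longrightarrow> P (p + q)"
    and "\<And>l c. l \<noteq> [] \<Longrightarrow> set l \<subseteq> {..<m} \<Longrightarrow> P (Poly_Mapping.single (Word l) c)"
  shows "P p"
proof (rule poly_mapping_additive_induct[of P])
  fix w c assume "w \<in> Poly_Mapping.keys p"
  with assms(1) show "P (Poly_Mapping.single w c)"
    using assms(4)[of "letters w" c] by (simp add: free_algebra_def)
qed (use assms in auto)

definition var :: "nat \<Rightarrow> (free_word \<Rightarrow>\<^sub>0 'f::field)" where
  "var k = Poly_Mapping.single (Word [k]) 1"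

lemma var_in_free_algebra: "k < m \<Longrightarrow> var k \<in> free_algebra m"
  by (simp add: var_def free_algebra_def)

lemma Word_plus: "Word l + Word l' = Word (l @ l')"
  by (simp add: plus_free_word_def)

lemma single_Word_Cons:
  "Poly_Mapping.single (Word (k # l)) c = var k * Poly_Mapping.single (Word l) c"
  by (simp add: var_def mult_single Word_plus)

lemma single_Word_singleton: "Poly_Mapping.single (Word [k]) c = free_scale c (var k)"
  by (rule poly_mapping_eqI) (simp add: var_def lookup_single when_def)

lemma free_algebra_add:
  "p \<in> free_algebra m \<Longrightarrow> q \<in> free_algebra m \<Longrightarrow> p + q \<in> free_algebra m"
  using subalgebra_free_algebra by (metis free.subalgebra_def free.subspace_add)

lemma free_algebra_diff:
  "p \<in> free_algebra m \<Longrightarrow> q \<in> free_algebra m \<Longrightarrow> p - q \<in> free_algebra m"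
  using subalgebra_free_algebra by (metis free.subalgebra_def free.subspace_diff)

lemma free_algebra_scale: "p \<in> free_algebra m \<Longrightarrow> free_scale c p \<in> free_algebra m"
  using subalgebra_free_algebra by (metis free.subalgebra_def free.subspace_scale)

lemma free_algebra_zero: "0 \<in> free_algebra m"
  by (simp add: free_algebra_def)

lemma free_algebra_sum:
  "(\<And>i. i \<in> S \<Longrightarrow> f i \<in> free_algebra m) \<Longrightarrow> sum f S \<in> free_algebra m"
  by (induction S rule: infinite_finite_induct) (auto intro: free_algebra_add free_algebra_zero)

lemma free_algebra_mult:
  "p \<in> free_algebra m \<Longrightarrow> q \<in> free_algebra m \<Longrightarrow> p * q \<in> free_algebra m"
  using subalgebra_free_algebra by (metis free.subalgebra_def)

context assoc_algebra
begin

lemma free_eval_zero [simp]: "free_eval b 0 = 0"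
  by (simp add: free_eval_def)

lemma free_eval_var [simp]: "free_eval b (var k) = b k"
  by (simp add: var_def)

lemma free_eval_diff: "free_eval b (p - q) = free_eval b p - free_eval b q"
  using free_eval_add[of b "p - q" q] by simp

lemma list_product_in_subalgebra:
  assumes "subalgebra B" "xs \<noteq> []" "set xs \<subseteq> B"
  shows "list_product xs \<in> B"
  using assms(2,3)
  by (induction xs rule: list_product.induct) (use assms(1) in \<open>auto simp: subalgebra_def\<close>)

lemma free_eval_in_subalgebra:
  assumes "subalgebra B" "\<And>k. k < m \<Longrightarrow> b k \<in> B" "p \<in> free_algebra m"
  shows "free_eval b p \<in> B"
  using assms(3)
proof (induction rule: free_algebra_induct)
  case zero
  then show ?case using assms(1) by (simp add: subalgebra_def subspace_0)
next
  case (add p q)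
  then show ?case using assms(1) by (simp add: free_eval_add subalgebra_def subspace_add)
next
  case (monomial l c)
  have "list_product (map b l) \<in> B"
    using monomial assms(2) by (intro list_product_in_subalgebra assms(1)) auto
  then show ?case
    using assms(1) by (simp add: subalgebra_def subspace_scale)
qed

lemma subalgebra_hull_eq_free_eval:
  "subalgebra hull (b ` {..<m}) = free_eval b ` free_algebra m"
proof (rule hull_unique)
  show "b ` {..<m} \<subseteq> free_eval b ` free_algebra m"
    by (metis (no_types, lifting) free_eval_var image_eqI image_subsetI lessThan_iff
        var_in_free_algebra)
  show "subalgebra (free_eval b ` free_algebra m)"
    unfolding subalgebra_def
  proof (intro conjI ballI subspaceI)
    show "0 \<in> free_eval b ` free_algebra m"
      by (rule image_eqI[of _ _ 0]) (simp_all add: free_algebra_zero)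
  qed (auto simp flip: free_eval_add free_eval_scale free_eval_mult
      intro!: imageI free_algebra_add free_algebra_scale free_algebra_mult)
  show "free_eval b ` free_algebra m \<subseteq> B" if "b ` {..<m} \<subseteq> B" "subalgebra B" for B
    using that by (auto intro!: free_eval_in_subalgebra[of _ m])
qed

lemma free_eval_substitution:
  assumes "\<And>k. k < m \<Longrightarrow> c k \<in> free_algebra m'" "p \<in> free_algebra m"
  shows "free_eval a (free.free_eval c p) = free_eval (\<lambda>k. free_eval a (c k)) p"
  using assms(2)
proof (induction rule: free_algebra_induct)
  case (monomial l x)
  have "free_eval a (list_product (map c l)) = list_product (map (\<lambda>k. free_eval a (c k)) l)"
    using monomial
  proof (induction l rule: induct_list012)
    case (3 k k' l)
    have "list_product (map c (k' # l)) \<in> free_algebra m'"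
      using 3 assms(1)
      by (intro free.list_product_in_subalgebra subalgebra_free_algebra) auto
    then show ?case
      using 3 assms(1) by (simp add: free_eval_mult[of _ m'])
  qed auto
  then show ?case
    by (simp add: free_eval_scale)
qed (simp_all add: free_eval_add free.free_eval_add free.free_eval_zero)

lemma ideal_of_free_eval_kernel:
  "free.ideal_of (free_algebra m) {p \<in> free_algebra m. free_eval b p = 0}"
  unfolding free.ideal_of_def
  by (auto intro!: free.subspaceI free_algebra_add free_algebra_zero free_algebra_scale
      free_algebra_mult simp: free_eval_add free_eval_scale free_eval_mult)

lemma ideal_of_Inter:
  assumes "\<And>I. I \<in> T \<Longrightarrow> ideal_of B I" "T \<noteq> {}"
  shows "ideal_of B (\<Inter>T)"
  using assms unfolding ideal_of_def
  by (auto intro!: subspace_Inter)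

lemma ideal_of_hull:
  assumes "subalgebra B" "R \<subseteq> B"
  shows "ideal_of B (ideal_of B hull R)"
proof -
  have "ideal_of B B"
    using assms(1) by (simp add: ideal_of_def subalgebra_def)
  then show ?thesis
    using assms(2) unfolding hull_def by (intro ideal_of_Inter) auto
qed

end


section \<open>Regrouping words between two factors\<close>

text \<open>
  The combinatorial shadow of factorizations \<open>x\<^sub>k = \<Sum>i\<in>I k. p\<^sub>i q\<^sub>i\<close> with \<open>n\<close> left and \<open>n\<close> right factors.
\<close>

locale factored_generators =
  fixes n :: nat and I :: "nat \<Rightarrow> nat set"
  assumes n_pos: "0 < n" and I_subset: "I k \<subseteq> {..<n}"
begin

text \<open>
  The variable that stands for \<open>q\<^sub>s p\<^sub>t\<close>; for \<open>s, t < n\<close> the pairs \<open>(s, t)\<close> are numbered by the numbers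
  below \<open>n * n\<close>.
\<close>

definition pairing :: "nat \<Rightarrow> nat \<Rightarrow> (free_word \<Rightarrow>\<^sub>0 'f::field)" where
  "pairing s t = var (s * n + t)"

text \<open>
  \<open>q\<^sub>s x\<^sub>k w p\<^sub>t\<close> is the sum of the \<open>(q\<^sub>s p\<^sub>i) (q\<^sub>i w p\<^sub>t)\<close>, which is where the recursion comes from.  The empty
  word, which stands for the formal unit, gives \<open>q\<^sub>s p\<^sub>t\<close>.
\<close>

primrec sandwich_word :: "nat list \<Rightarrow> nat \<Rightarrow> nat \<Rightarrow> (free_word \<Rightarrow>\<^sub>0 'f::field)" where
  "sandwich_word [] s t = pairing s t"
| "sandwich_word (k # l) s t = (\<Sum>i\<in>I k. pairing s i * sandwich_word l i t)"

definition sandwich :: "nat \<Rightarrow> nat \<Rightarrow> (free_word \<Rightarrow>\<^sub>0 'f::field) \<Rightarrow> (free_word \<Rightarrow>\<^sub>0 'f)" where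
  "sandwich s t p =
    (\<Sum>w\<in>Poly_Mapping.keys p. free_scale (Poly_Mapping.lookup p w) (sandwich_word (letters w) s t))"

lemma pairing_in_free_algebra: "s < n \<Longrightarrow> t < n \<Longrightarrow> pairing s t \<in> free_algebra (n * n)"
  unfolding pairing_def
  by (rule var_in_free_algebra)
    (metis add.commute add_less_mono1 less_le_trans mult_Suc mult_le_mono1 Suc_leI)

lemma in_I_less: "i \<in> I k \<Longrightarrow> i < n"
  using I_subset by blast

lemma sandwich_word_in_free_algebra:
  "s < n \<Longrightarrow> t < n \<Longrightarrow> sandwich_word l s t \<in> free_algebra (n * n)"
  by (induction l arbitrary: s)
    (auto intro!: pairing_in_free_algebra free_algebra_sum free_algebra_mult in_I_less)

lemma sandwich_in_free_algebra:
  "s < n \<Longrightarrow> t < n \<Longrightarrow> sandwich s t p \<in> free_algebra (n * n)"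
  unfolding sandwich_def
  by (intro free_algebra_sum free_algebra_scale sandwich_word_in_free_algebra)

lemma sandwich_zero [simp]: "sandwich s t 0 = 0"
  by (simp add: sandwich_def)

lemma sandwich_single [simp]:
  "sandwich s t (Poly_Mapping.single w c) = free_scale c (sandwich_word (letters w) s t)"
  by (cases "c = 0") (simp_all add: sandwich_def)

lemma sandwich_superset:
  assumes "finite S" "Poly_Mapping.keys p \<subseteq> S"
  shows "sandwich s t p =
    (\<Sum>w\<in>S. free_scale (Poly_Mapping.lookup p w) (sandwich_word (letters w) s t))"
  unfolding sandwich_def
  by (rule sum.mono_neutral_left) (use assms in \<open>auto simp: in_keys_iff\<close>)

lemma sandwich_add: "sandwich s t (p + q) = sandwich s t p + sandwich s t q"
proof -
  let ?S = "Poly_Mapping.keys p \<union> Poly_Mapping.keys q"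
  have "Poly_Mapping.keys (p + q) \<subseteq> ?S"
    by (rule keys_add)
  then show ?thesis
    by (simp add: sandwich_superset[of ?S] lookup_add free.scale_left_distrib sum.distrib)
qed

lemma sandwich_scale: "sandwich s t (free_scale c p) = free_scale c (sandwich s t p)"
proof -
  have "Poly_Mapping.keys (free_scale c p) \<subseteq> Poly_Mapping.keys p"
    by (auto simp: in_keys_iff)
  then show ?thesis
    by (simp add: sandwich_superset[of "Poly_Mapping.keys p"] free.scale_sum_right)
qed

lemma sandwich_word_append_Cons:
  "(sandwich_word (l @ k # l') s t :: free_word \<Rightarrow>\<^sub>0 'f::field) =
    (\<Sum>i\<in>I k. sandwich_word l s i * sandwich_word l' i t)"
proof (induction l arbitrary: s)
  case (Cons j l)
  have "(sandwich_word ((j # l) @ k # l') s t :: free_word \<Rightarrow>\<^sub>0 'f) =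
      (\<Sum>h\<in>I j. \<Sum>i\<in>I k. pairing s h * sandwich_word l h i * sandwich_word l' i t)"
    by (simp add: Cons.IH sum_distrib_left mult.assoc)
  also have "\<dots> = (\<Sum>i\<in>I k. \<Sum>h\<in>I j. pairing s h * sandwich_word l h i * sandwich_word l' i t)"
    by (rule sum.swap)
  finally show ?case
    by (simp add: sum_distrib_right)
qed simp

text \<open>
  The substitute for multiplicativity: a product can be split only at an occurrence of a variable,
  because it is the variable that provides the inner factors \<open>p\<^sub>i\<close> and \<open>q\<^sub>i\<close>.
\<close>

lemma sandwich_mult_var_mult:
  "sandwich s t (p * (var k * q)) = (\<Sum>i\<in>I k. sandwich s i p * sandwich i t q)"
proof (rule poly_mapping_additive_induct[of _ p])
  fix u c
  show "sandwich s t (Poly_Mapping.single u c * (var k * q)) =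
      (\<Sum>i\<in>I k. sandwich s i (Poly_Mapping.single u c) * sandwich i t q)"
  proof (rule poly_mapping_additive_induct[of _ q])
    fix v d
    show "sandwich s t (Poly_Mapping.single u c * (var k * Poly_Mapping.single v d)) =
      (\<Sum>i\<in>I k. sandwich s i (Poly_Mapping.single u c) * sandwich i t (Poly_Mapping.single v d))"
      by (simp add: var_def mult_single sandwich_word_append_Cons free.scale_mult_left
          free.scale_mult_right free.scale_sum_right mult.commute)
  qed (simp_all add: sandwich_add distrib_left sum.distrib)
qed (simp_all add: sandwich_add distrib_right sum.distrib)

text \<open>
  Relations of \<open>A\<close> become relations of the corner.  When an element is multiplied by a nonempty
  word, splitting at the letter of the word next to the element leaves a sandwich of the element
  as one factor of each summand.
\<close>

lemma sandwich_preserves_ideal: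
  assumes J: "free.ideal_of (free_algebra (n * n)) J"
    and R: "\<And>r s t. r \<in> R \<Longrightarrow> s < n \<Longrightarrow> t < n \<Longrightarrow> sandwich s t r \<in> J"
    and "R \<subseteq> free_algebra m"
    and g: "g \<in> free.ideal_of (free_algebra m) hull R"
    and st: "s < n" "t < n"
  shows "sandwich s t g \<in> J"
proof -
  let ?K = "{g \<in> free_algebra m. \<forall>s<n. \<forall>t<n. sandwich s t g \<in> J}"
  have sub: "free.subspace J"
    using J by (simp add: free.ideal_of_def)
  have absorb: "x * y \<in> J" "y * x \<in> J" if "x \<in> free_algebra (n * n)" "y \<in> J" for x y
    using J that by (auto simp: free.ideal_of_def)
  \<comment> \<open>Only multiplication by monomials has to be examined, as the sandwich is linear.\<close>
  have "b * x \<in> ?K \<and> x * b \<in> ?K" if "b \<in> free_algebra m" "x \<in> ?K" for b x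
    using that(1)
  proof (induction rule: free_algebra_induct)
    case zero
    then show ?case
      using sub by (simp add: free_algebra_zero free.subspace_0)
  next
    case (add p q)
    then show ?case
      using sub by (simp add: distrib_left distrib_right free_algebra_add sandwich_add
          free.subspace_add)
  next
    case (monomial l c)
    have mon: "Poly_Mapping.single (Word l) c \<in> free_algebra m"
      using monomial by (simp add: free_algebra_def)
    obtain k l1 where l1: "l = k # l1"
      using monomial by (cases l) auto
    obtain k' l2 where l2: "l = l2 @ [k']"
      using monomial by (metis rev_exhaust)
    have "sandwich s t (Poly_Mapping.single (Word l) c * x) \<in> J" if "s < n" "t < n" for s t
    proof -
      have "Poly_Mapping.single (Word l) c * x =
          Poly_Mapping.single (Word l2) c * (var k' * x)"
        by (simp add: l2 var_def mult_single Word_plus flip: mult.assoc)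
      then show ?thesis
        using \<open>x \<in> ?K\<close> that in_I_less
        by (auto simp: sandwich_mult_var_mult simp del: sandwich_single
            intro!: free.subspace_sum[OF sub] absorb(1) sandwich_in_free_algebra)
    qed
    moreover have "sandwich s t (x * Poly_Mapping.single (Word l) c) \<in> J" if "s < n" "t < n" for s t
      unfolding l1 single_Word_Cons
      using \<open>x \<in> ?K\<close> that in_I_less
      by (auto simp: sandwich_mult_var_mult simp del: sandwich_single
          intro!: free.subspace_sum[OF sub] absorb(2) sandwich_in_free_algebra)
    ultimately show ?case
      using mon \<open>x \<in> ?K\<close> by (auto intro: free_algebra_mult)
  qed
  moreover have "free.subspace ?K"
    using sub by (auto intro!: free.subspaceI simp: free_algebra_zero free_algebra_add
        free_algebra_scale sandwich_add sandwich_scale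
        free.subspace_0 free.subspace_add free.subspace_scale)
  ultimately have "free.ideal_of (free_algebra m) ?K"
    by (auto simp: free.ideal_of_def)
  then have "free.ideal_of (free_algebra m) hull R \<subseteq> ?K"
    using R assms(3) by (intro hull_minimal) auto
  then show ?thesis
    using g st by blast
qed

end

section \<open>Defining relations of the corner\<close>

text \<open>
  An ideal \<open>J\<close> that contains the relations which make \<open>q\<^sub>0 p\<^sub>0 = e\<close> a unit and which express that
  \<open>right u\<close> and \<open>left v\<close> have the values \<open>q\<^sub>u = e q\<^sub>u = p\<^sub>0 q\<^sub>u\<close> and \<open>p\<^sub>v = p\<^sub>v e = p\<^sub>v q\<^sub>0\<close>.
\<close>

locale corner_relations = factored_generators +
  fixes J :: "(free_word \<Rightarrow>\<^sub>0 'f::field) set"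
    and m :: nat
    and left right :: "nat \<Rightarrow> (free_word \<Rightarrow>\<^sub>0 'f)"
  assumes ideal: "free.ideal_of (free_algebra (n * n)) J"
    and right_in_free_algebra: "s < n \<Longrightarrow> right s \<in> free_algebra m"
    and left_in_free_algebra: "t < n \<Longrightarrow> left t \<in> free_algebra m"
    and unit_left: "s < n \<Longrightarrow> t < n \<Longrightarrow> pairing 0 0 * pairing s t - pairing s t \<in> J"
    and unit_right: "s < n \<Longrightarrow> t < n \<Longrightarrow> pairing s t * pairing 0 0 - pairing s t \<in> J"
    and sandwich_right:
      "s < n \<Longrightarrow> t < n \<Longrightarrow> u < n \<Longrightarrow> sandwich s t (right u) - pairing s 0 * pairing u t \<in> J"
    and sandwich_left:
      "s < n \<Longrightarrow> t < n \<Longrightarrow> v < n \<Longrightarrow> sandwich s t (left v) - pairing s v * pairing 0 t \<in> J"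
begin

lemma subspace_J: "free.subspace J"
  using ideal by (simp add: free.ideal_of_def)

lemma J_mult_left: "x \<in> free_algebra (n * n) \<Longrightarrow> y \<in> J \<Longrightarrow> x * y \<in> J"
  and J_mult_right: "x \<in> free_algebra (n * n) \<Longrightarrow> y \<in> J \<Longrightarrow> y * x \<in> J"
  using ideal by (auto simp: free.ideal_of_def)

lemma J_trans: "x - y \<in> J \<Longrightarrow> y - z \<in> J \<Longrightarrow> x - z \<in> J"
  using free.subspace_add[OF subspace_J, of "x - y" "y - z"] by simp

text \<open>
  If modulo \<open>J\<close> the element \<open>f\<close> behaves on the right of \<open>q\<^sub>s\<close> like \<open>z q\<^sub>u\<close>, then this remains so when a
  further factor \<open>g\<close> follows: split \<open>f g\<close> at the first letter of each word of \<open>g\<close>.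
\<close>

lemma sandwich_mult_cong:
  assumes f: "\<And>i. i < n \<Longrightarrow> sandwich s i f - z * pairing u i \<in> J"
    and g: "g \<in> free_algebra m'"
    and st: "s < n" "t < n"
  shows "sandwich s t (f * g) - z * sandwich u t g \<in> J"
  using g
proof (induction rule: free_algebra_induct)
  case zero
  then show ?case by (simp add: free.subspace_0[OF subspace_J])
next
  case (add p q)
  have "sandwich s t (f * (p + q)) - z * sandwich u t (p + q) =
      (sandwich s t (f * p) - z * sandwich u t p) + (sandwich s t (f * q) - z * sandwich u t q)"
    by (simp add: sandwich_add distrib_left)
  then show ?case
    using add by (simp only: free.subspace_add[OF subspace_J])
next
  case (monomial l c)
  then obtain k l' where l: "l = k # l'"
    by (cases l) auto
  let ?w = "Poly_Mapping.single (Word l') c"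
  have "sandwich u t (var k * ?w) = (\<Sum>i\<in>I k. pairing u i * sandwich i t ?w)"
    by (simp add: var_def mult_single free.scale_sum_right free.scale_mult_right)
  then have "sandwich s t (f * (var k * ?w)) - z * sandwich u t (var k * ?w) =
      (\<Sum>i\<in>I k. (sandwich s i f - z * pairing u i) * sandwich i t ?w)"
    by (simp only: sandwich_mult_var_mult sum_distrib_left sum_subtractf[symmetric]
        left_diff_distrib mult.assoc)
  also have "\<dots> \<in> J"
    using in_I_less st
    by (auto simp del: sandwich_single
        intro!: free.subspace_sum[OF subspace_J] J_mult_right f sandwich_in_free_algebra)
  finally show ?case
    by (simp only: l single_Word_Cons)
qed

definition substitute :: "(free_word \<Rightarrow>\<^sub>0 'f) \<Rightarrow> (free_word \<Rightarrow>\<^sub>0 'f)" where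
  "substitute = free.free_eval (\<lambda>k. right (k div n) * left (k mod n))"

lemma index_less:
  assumes "k < n * n"
  shows "k div n < n" "k mod n < n"
  using assms n_pos by (auto simp: less_mult_imp_div_less)

lemma substitute_in_free_algebra:
  assumes "f \<in> free_algebra (n * n)"
  shows "substitute f \<in> free_algebra m"
  unfolding substitute_def using assms
  by (intro free.free_eval_in_subalgebra[of _ "n * n"] subalgebra_free_algebra free_algebra_mult
      right_in_free_algebra left_in_free_algebra index_less)

lemma pairing_div_mod: "pairing (k div n) (k mod n) = var k"
  by (simp add: pairing_def)

text \<open>
  Modulo \<open>J\<close> the factor \<open>right u\<close> turns into \<open>q\<^sub>s p\<^sub>0\<close> followed by \<open>q\<^sub>u\<close>, and then \<open>left v\<close> between \<open>q\<^sub>u\<close>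
  and \<open>p\<^sub>t\<close> gives \<open>q\<^sub>u p\<^sub>v\<close> followed by \<open>q\<^sub>0 p\<^sub>t\<close>.
\<close>

lemma sandwich_substitute_var:
  assumes "s < n" "t < n" "k < n * n"
  shows "sandwich s t (substitute (var k)) - pairing s 0 * var k * pairing 0 t \<in> J"
proof -
  let ?u = "k div n" and ?v = "k mod n"
  note uv = index_less[OF assms(3)]
  have "sandwich s t (right ?u * left ?v) - pairing s 0 * sandwich ?u t (left ?v) \<in> J"
    using assms uv by (intro sandwich_mult_cong[of _ _ _ _ _ m] sandwich_right left_in_free_algebra)
  moreover have "pairing s 0 * (sandwich ?u t (left ?v) - pairing ?u ?v * pairing 0 t) \<in> J"
    using assms uv n_pos by (intro J_mult_left sandwich_left pairing_in_free_algebra)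
  ultimately show ?thesis
    unfolding right_diff_distrib
    by (auto intro: J_trans simp: substitute_def pairing_div_mod mult.assoc)
qed

text \<open>
  Induction on the word: its first variable contributes itself, followed by a factor \<open>q\<^sub>0\<close> for the
  rest of the word; the pairing \<open>q\<^sub>0 p\<^sub>0\<close> that arises between the two is absorbed as a unit.
\<close>

lemma sandwich_substitute_monomial:
  assumes "l \<noteq> []" "set l \<subseteq> {..<n * n}" "s < n" "t < n"
  shows "sandwich s t (substitute (Poly_Mapping.single (Word l) c)) -
    pairing s 0 * Poly_Mapping.single (Word l) c * pairing 0 t \<in> J"
  using assms
proof (induction l arbitrary: s rule: list_nonempty_induct)
  case (single k)
  have "free_scale c (sandwich s t (substitute (var k)) - pairing s 0 * var k * pairing 0 t) \<in> J"
    using single by (intro free.subspace_scale[OF subspace_J] sandwich_substitute_var) auto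
  then show ?case
    by (simp only: single_Word_singleton substitute_def free.free_eval_scale sandwich_scale
        free.scale_mult_left free.scale_mult_right free.scale_right_diff_distrib)
next
  case (cons k l)
  let ?w = "Poly_Mapping.single (Word l) c"
  have k: "var k \<in> free_algebra (n * n)" and w: "?w \<in> free_algebra (n * n)"
    using cons by (simp_all add: var_in_free_algebra) (simp add: free_algebra_def)
  have s0: "pairing s 0 \<in> free_algebra (n * n)" and t0: "pairing 0 t \<in> free_algebra (n * n)"
    using cons n_pos by (auto intro: pairing_in_free_algebra)
  have "sandwich s t (substitute (var k) * substitute ?w) -
      pairing s 0 * var k * sandwich 0 t (substitute ?w) \<in> J"
    using cons k w
    by (intro sandwich_mult_cong[of _ _ _ _ _ m] sandwich_substitute_var substitute_in_free_algebra)
      auto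
  moreover have "pairing s 0 * var k *
      (sandwich 0 t (substitute ?w) - pairing 0 0 * ?w * pairing 0 t) \<in> J"
    using cons n_pos s0 k by (intro J_mult_left free_algebra_mult cons.IH) auto
  moreover have "pairing s 0 * (var k * pairing 0 0 - var k) * (?w * pairing 0 t) \<in> J"
    unfolding pairing_div_mod[of k, symmetric] using s0 t0 w cons index_less
    by (intro J_mult_right J_mult_left unit_right free_algebra_mult) auto
  ultimately have "sandwich s t (substitute (var k) * substitute ?w) -
      pairing s 0 * (var k * ?w) * pairing 0 t \<in> J"
    unfolding right_diff_distrib left_diff_distrib mult.assoc
    by (meson J_trans)
  moreover have "substitute (var k * ?w) = substitute (var k) * substitute ?w"
    unfolding substitute_def using k w by (rule free.free_eval_mult)
  ultimately show ?case
    by (simp only: single_Word_Cons)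
qed

lemma unit_mult_monomial:
  assumes "l \<noteq> []" "set l \<subseteq> {..<n * n}"
  shows "pairing 0 0 * Poly_Mapping.single (Word l) c - Poly_Mapping.single (Word l) c \<in> J"
proof -
  obtain k l' where l: "l = k # l'"
    using assms by (cases l) auto
  have k: "pairing 0 0 * var k - var k \<in> J"
    using unit_left[of "k div n" "k mod n"] index_less[of k] assms l
    by (simp add: pairing_div_mod)
  show ?thesis
  proof (cases "l' = []")
    case True
    then show ?thesis
      using free.subspace_scale[OF subspace_J k, of c]
      by (simp add: l single_Word_singleton free.scale_mult_right free.scale_right_diff_distrib)
  next
    case False
    then have "(pairing 0 0 * var k - var k) * Poly_Mapping.single (Word l') c \<in> J"
      using assms l by (intro J_mult_right k) (auto simp: free_algebra_def)
    then show ?thesis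
      by (simp add: l single_Word_Cons left_diff_distrib mult.assoc)
  qed
qed

lemma monomial_mult_unit:
  assumes "l \<noteq> []" "set l \<subseteq> {..<n * n}"
  shows "Poly_Mapping.single (Word l) c * pairing 0 0 - Poly_Mapping.single (Word l) c \<in> J"
proof -
  obtain k l' where l: "l = l' @ [k]"
    using assms by (metis rev_exhaust)
  have k: "var k * pairing 0 0 - var k \<in> J"
    using unit_right[of "k div n" "k mod n"] index_less[of k] assms l
    by (simp add: pairing_div_mod)
  show ?thesis
  proof (cases "l' = []")
    case True
    then show ?thesis
      using free.subspace_scale[OF subspace_J k, of c]
      by (simp add: l single_Word_singleton free.scale_mult_left free.scale_right_diff_distrib)
  next
    case False
    then have "Poly_Mapping.single (Word l') c * (var k * pairing 0 0 - var k) \<in> J"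
      using assms l by (intro J_mult_left k) (auto simp: free_algebra_def)
    moreover have "Poly_Mapping.single (Word l) c = Poly_Mapping.single (Word l') c * var k"
      by (simp add: l var_def mult_single Word_plus)
    ultimately show ?thesis
      by (simp add: right_diff_distrib mult.assoc)
  qed
qed

text \<open>
  Lifting a polynomial to \<open>A\<close> by substitution and coming back by the sandwich between \<open>q\<^sub>0\<close> and
  \<open>p\<^sub>0\<close> loses nothing modulo \<open>J\<close>.  This is the heart of the proof: it shows that \<open>J\<close> is large enough.
\<close>

lemma sandwich_substitute:
  assumes "f \<in> free_algebra (n * n)"
  shows "sandwich 0 0 (substitute f) - f \<in> J"
  using assms
proof (induction rule: free_algebra_induct)
  case zero
  then show ?case by (simp add: substitute_def free.subspace_0[OF subspace_J])
next
  case (add p q)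
  have "sandwich 0 0 (substitute (p + q)) - (p + q) =
      (sandwich 0 0 (substitute p) - p) + (sandwich 0 0 (substitute q) - q)"
    by (simp add: substitute_def free.free_eval_add sandwich_add)
  then show ?case
    using add by (simp only: free.subspace_add[OF subspace_J])
next
  case (monomial l c)
  let ?w = "Poly_Mapping.single (Word l) c"
  have "sandwich 0 0 (substitute ?w) - pairing 0 0 * ?w * pairing 0 0 \<in> J"
    using monomial n_pos by (intro sandwich_substitute_monomial)
  moreover have "(pairing 0 0 * ?w - ?w) * pairing 0 0 \<in> J"
    using monomial n_pos by (intro J_mult_right unit_mult_monomial pairing_in_free_algebra)
  moreover have "?w * pairing 0 0 - ?w \<in> J"
    using monomial by (rule monomial_mult_unit)
  ultimately show ?case
    unfolding left_diff_distrib by (meson J_trans)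
qed

end


section \<open>The presentation of the Peirce component\<close>

context assoc_algebra
begin

lemma factorization_through_idempotent:
  assumes "e * e = e" "x \<in> span {a * e * b | a b. True}"
  shows "\<exists>(l::nat) p q. x = (\<Sum>i<l. p i * q i) \<and> (\<forall>i<l. p i * e = p i \<and> e * q i = q i)"
  using assms(2)
proof (induction rule: span_induct_alt)
  case base
  show ?case by (rule exI[of _ "0::nat"]) simp
next
  case (step c x y)
  then obtain a b p q and l :: nat where x: "x = a * e * b" and y: "y = (\<Sum>i<l. p i * q i)"
    and pq: "\<forall>i<l. p i * e = p i \<and> e * q i = q i"
    by blast
  have "(a * e) * e = a * e" "e * (e * b) = e * b" "(a * e) * (e * b) = a * e * b"
    using assms(1) by (simp_all add: mult.assoc) (metis assms(1) mult.assoc)+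
  then show ?case
    using pq
    by (intro exI[of _ "Suc l"] exI[of _ "p(l := c *s (a * e))"] exI[of _ "q(l := e * b)"])
      (auto simp: x y scale_mult_left add.commute less_Suc_eq)
qed

text \<open>
  Sums for different generators use disjoint blocks of indices; the index \<open>0\<close> is reserved for
  the pair \<open>(e, e)\<close>, through which the corner \<open>eAe\<close> is reached.
\<close>

lemma common_factorization:
  fixes e :: 'a and x :: "nat \<Rightarrow> 'a"
  assumes "e * e = e" "span {a * e * b | a b. True} = UNIV"
  obtains n :: nat and I p q where "0 < n" "p 0 = e" "q 0 = e"
    "\<And>i. i < n \<Longrightarrow> p i * e = p i" "\<And>i. i < n \<Longrightarrow> e * q i = q i"
    "\<And>k. I k \<subseteq> {..<n}" "\<And>k. k < m \<Longrightarrow> x k = (\<Sum>i\<in>I k. p i * q i)"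
proof -
  have "\<exists>(n::nat) I p q. 0 < n \<and> p 0 = e \<and> q 0 = e \<and> (\<forall>i<n. p i * e = p i \<and> e * q i = q i) \<and>
    (\<forall>k. I k \<subseteq> {..<n}) \<and> (\<forall>k<m. x k = (\<Sum>i\<in>I k. p i * q i))"
  proof (induction m)
    case 0
    show ?case
      using assms(1)
      by (intro exI[of _ "1::nat"] exI[of _ "\<lambda>_. {}"] exI[of _ "\<lambda>_. e"]) simp
  next
    case (Suc m)
    then obtain n :: nat and I p q where IH: "0 < n" "p 0 = e" "q 0 = e"
      "\<forall>i<n. p i * e = p i \<and> e * q i = q i"
      "\<forall>k. I k \<subseteq> {..<n}" "\<forall>k<m. x k = (\<Sum>i\<in>I k. p i * q i)"
      by blast
    obtain l :: nat and p' q' where new: "x m = (\<Sum>i<l. p' i * q' i)"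
      "\<forall>i<l. p' i * e = p' i \<and> e * q' i = q' i"
      using factorization_through_idempotent[of e "x m"] assms by auto
    let ?p = "\<lambda>i. if i < n then p i else p' (i - n)"
    let ?q = "\<lambda>i. if i < n then q i else q' (i - n)"
    let ?I = "I(m := {n..<n + l})"
    have "\<forall>k<Suc m. x k = (\<Sum>i\<in>?I k. ?p i * ?q i)"
    proof (intro allI impI)
      fix k assume "k < Suc m"
      show "x k = (\<Sum>i\<in>?I k. ?p i * ?q i)"
      proof (cases "k = m")
        case True
        have "(\<Sum>i<l. p' i * q' i) = (\<Sum>i\<in>{n..<n + l}. ?p i * ?q i)"
          by (rule sum.reindex_bij_witness[of _ "\<lambda>i. i - n" "\<lambda>i. i + n"]) auto
        then show ?thesis
          using True new by simp
      next
        case False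
        then have "x k = (\<Sum>i\<in>I k. p i * q i)"
          using \<open>k < Suc m\<close> IH by simp
        also have "\<dots> = (\<Sum>i\<in>I k. ?p i * ?q i)"
          using IH(5) by (intro sum.cong) auto
        finally show ?thesis
          using False by simp
      qed
    qed
    moreover have "\<forall>i<n + l. ?p i * e = ?p i \<and> e * ?q i = ?q i"
      using IH(4) new(2) by auto
    moreover have "\<forall>k. ?I k \<subseteq> {..<n + l}"
    proof
      show "?I k \<subseteq> {..<n + l}" for k
        using IH(5)[rule_format, of k] by auto
    qed
    moreover have "0 < n + l" "?p 0 = e" "?q 0 = e"
      using IH by simp_all
    ultimately show ?case
      by (intro exI[of _ "n + l"] exI[of _ ?I] exI[of _ ?p] exI[of _ ?q] conjI)
  qed
  then show thesis
    using that by blast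
qed

text \<open>
  This is what the sandwich was made for: it computes, in the variables for the \<open>q\<^sub>s p\<^sub>t\<close>, the
  value of a polynomial in the generators placed between two factors.
\<close>

lemma free_eval_sandwich:
  assumes "factored_generators n I"
    and "\<And>k. k < m \<Longrightarrow> x k = (\<Sum>i\<in>I k. p i * q i)"
    and b: "\<And>s t. s < n \<Longrightarrow> t < n \<Longrightarrow> b (s * n + t) = q s * p t"
    and "f \<in> free_algebra m"
    and st: "s < n" "t < n"
  shows "free_eval b (factored_generators.sandwich n I s t f) = q s * free_eval x f * p t"
proof -
  interpret factored_generators n I by fact
  have pairing: "free_eval b (pairing s t) = q s * p t" if "s < n" "t < n" for s t
    using that by (simp add: pairing_def b)
  show ?thesis
    using assms(4)
  proof (induction rule: free_algebra_induct)
    case (monomial l c)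
    have "free_eval b (sandwich_word l s t) = q s * list_product (map x l) * p t"
      using monomial st(1)
    proof (induction l arbitrary: s rule: list_nonempty_induct)
      case (single k)
      have "free_eval b (sandwich_word [k] s t) = (\<Sum>i\<in>I k. q s * p i * (q i * p t))"
        using single st in_I_less
        by (simp add: free_eval_sum)
          (auto simp: pairing free_eval_mult[of _ "n * n"] pairing_in_free_algebra
            intro!: sum.cong)
      also have "\<dots> = q s * x k * p t"
        using single by (simp add: assms(2) sum_distrib_left sum_distrib_right mult.assoc)
      finally show ?case
        by simp
    next
      case (cons k l)
      have "free_eval b (sandwich_word (k # l) s t) =
          (\<Sum>i\<in>I k. q s * p i * (q i * list_product (map x l) * p t))"
        using cons st in_I_less
        by (simp add: free_eval_sum)
          (auto simp: pairing free_eval_mult[of _ "n * n"] pairing_in_free_algebra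
            sandwich_word_in_free_algebra intro!: sum.cong)
      also have "\<dots> = q s * (x k * list_product (map x l)) * p t"
        using cons by (simp add: assms(2) sum_distrib_left sum_distrib_right mult.assoc)
      also have "x k * list_product (map x l) = list_product (map x (k # l))"
        using cons(1) by (cases l) auto
      finally show ?case .
    qed
    then show ?case
      by (simp add: free_eval_scale scale_mult_left scale_mult_right)
  qed (simp_all add: sandwich_add free_eval_add distrib_left distrib_right)
qed

text \<open>
  The relations generate an ideal \<open>J\<close> inside the kernel \<open>?K\<close> of the evaluation at the \<open>q\<^sub>s p\<^sub>t\<close>.
  Conversely, a polynomial in the kernel lifts to a consequence of the relations of \<open>A\<close>, and
  the sandwich of the latter is in \<open>J\<close> and congruent to the polynomial.
\<close>

lemma peirce_finitely_presented:
  assumes fp: "finitely_presented UNIV"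
    and e: "e * e = e"
    and full: "span {a * e * b | a b. True} = UNIV"
  shows "finitely_presented (peirce e)"
proof -
  obtain m x R where gen: "subalgebra hull (x ` {..<m}) = UNIV"
    and R: "finite R" "R \<subseteq> free_algebra m"
    and hull_R: "free.ideal_of (free_algebra m) hull R = {f \<in> free_algebra m. free_eval x f = 0}"
    using fp unfolding finitely_presented_def free.finitely_generated_ideal_def by blast
  obtain n :: nat and I p q where n: "0 < n" and pq0: "p 0 = e" "q 0 = e"
    and p: "\<And>i. i < n \<Longrightarrow> p i * e = p i" and q: "\<And>i. i < n \<Longrightarrow> e * q i = q i"
    and I: "\<And>k. I k \<subseteq> {..<n}" and x: "\<And>k. k < m \<Longrightarrow> x k = (\<Sum>i\<in>I k. p i * q i)"
    by (rule common_factorization[OF e full, of m x]) (rule that; assumption)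
  interpret factored_generators n I
    by unfold_locales (use n I in auto)
  have "\<exists>f\<in>free_algebra m. free_eval x f = y" for y
    using gen unfolding subalgebra_hull_eq_free_eval by (metis UNIV_I imageE)
  \<comment> \<open>\<open>h\<close> chooses a polynomial in the generators with a given value.\<close>
  then obtain h where h: "\<And>y. h y \<in> free_algebra m" "\<And>y. free_eval x (h y) = y"
    by metis
  define left right where "left = h \<circ> p" and "right = h \<circ> q"
  define b where "b k = q (k div n) * p (k mod n)" for k
  have b: "b (s * n + t) = q s * p t" if "s < n" "t < n" for s t
    using that by (simp add: b_def)
  note eval_sandwich = free_eval_sandwich[OF factored_generators_axioms x b]
  have eval_pairing: "free_eval b (pairing s t) = q s * p t" if "s < n" "t < n" for s t
    using that by (simp add: pairing_def b)
  let ?M = "n * n"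
  let ?K = "{f \<in> free_algebra ?M. free_eval b f = 0}"
  define relations where "relations s t =
      {pairing 0 0 * pairing s t - pairing s t, pairing s t * pairing 0 0 - pairing s t}
      \<union> sandwich s t ` R
      \<union> (\<lambda>u. sandwich s t (right u) - pairing s 0 * pairing u t) ` {..<n}
      \<union> (\<lambda>v. sandwich s t (left v) - pairing s v * pairing 0 t) ` {..<n}" for s t
  define S where "S = (\<Union>s\<in>{..<n}. \<Union>t\<in>{..<n}. relations s t)"
  define J where "J = free.ideal_of (free_algebra ?M) hull S"
  have "finite S"
    unfolding S_def relations_def using R by auto
  have R_zero: "free_eval x r = 0" if "r \<in> R" for r
    using hull_R hull_inc[OF that, of "free.ideal_of (free_algebra m)"] by auto
  have corner: "e * (q s * p t) = q s * p t" "q s * p t * e = q s * p t" if "s < n" "t < n" for s t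
    using p[OF that(2)] q[OF that(1)] by (metis mult.assoc)+
  have "S \<subseteq> ?K"
  proof
    fix g assume "g \<in> S"
    then obtain s t where st: "s < n" "t < n" and
      "g = pairing 0 0 * pairing s t - pairing s t \<or> g = pairing s t * pairing 0 0 - pairing s t \<or>
       (\<exists>r\<in>R. g = sandwich s t r) \<or>
       (\<exists>u<n. g = sandwich s t (right u) - pairing s 0 * pairing u t) \<or>
       (\<exists>v<n. g = sandwich s t (left v) - pairing s v * pairing 0 t)"
      unfolding S_def relations_def by blast
    then consider "g = pairing 0 0 * pairing s t - pairing s t"
      | "g = pairing s t * pairing 0 0 - pairing s t"
      | r where "r \<in> R" "g = sandwich s t r"
      | u where "u < n" "g = sandwich s t (right u) - pairing s 0 * pairing u t"
      | v where "v < n" "g = sandwich s t (left v) - pairing s v * pairing 0 t"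
      by blast
    then show "g \<in> ?K"
    proof cases
      case 1
      then show ?thesis
        using n st by (simp add: free_algebra_diff free_algebra_mult pairing_in_free_algebra
            free_eval_diff free_eval_mult[of _ ?M] eval_pairing pq0 e corner)
    next
      case 2
      then show ?thesis
        using n st by (simp add: free_algebra_diff free_algebra_mult pairing_in_free_algebra
            free_eval_diff free_eval_mult[of _ ?M] eval_pairing pq0 e corner)
    next
      case 3
      then show ?thesis
        using st R(2) by (simp add: sandwich_in_free_algebra eval_sandwich R_zero subset_iff)
    next
      case 4
      then show ?thesis
        using n st by (simp add: free_algebra_diff free_algebra_mult pairing_in_free_algebra
            sandwich_in_free_algebra free_eval_diff free_eval_mult[of _ ?M] eval_pairing
            eval_sandwich right_def h pq0)
          (metis mult.assoc q)
    next
      case 5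
      then show ?thesis
        using n st by (simp add: free_algebra_diff free_algebra_mult pairing_in_free_algebra
            sandwich_in_free_algebra free_eval_diff free_eval_mult[of _ ?M] eval_pairing
            eval_sandwich left_def h pq0)
          (metis mult.assoc p)
    qed
  qed
  have "J \<subseteq> ?K"
    unfolding J_def by (intro hull_minimal \<open>S \<subseteq> ?K\<close> ideal_of_free_eval_kernel)
  have relations_in_J: "g \<in> J" if "s < n" "t < n" "g \<in> relations s t" for g s t
    unfolding J_def S_def using that by (intro hull_inc) auto
  interpret corner_relations n I J m left right
  proof
    show "free.ideal_of (free_algebra ?M) J"
      unfolding J_def using \<open>S \<subseteq> ?K\<close>
      by (intro free.ideal_of_hull subalgebra_free_algebra) auto
    fix s t u assume st: "s < n" "t < n"
    show "pairing 0 0 * pairing s t - pairing s t \<in> J"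
      and "pairing s t * pairing 0 0 - pairing s t \<in> J"
      and "u < n \<Longrightarrow> sandwich s t (right u) - pairing s 0 * pairing u t \<in> J"
      and "u < n \<Longrightarrow> sandwich s t (left u) - pairing s u * pairing 0 t \<in> J"
      by (auto intro!: relations_in_J[OF st] simp: relations_def)
  qed (simp_all add: left_def right_def h)
  have "?K \<subseteq> J"
  proof
    fix f assume "f \<in> ?K"
    then have f: "f \<in> free_algebra ?M" "free_eval b f = 0"
      by auto
    have "free_eval x (substitute f) = free_eval (\<lambda>k. free_eval x (right (k div n) * left (k mod n))) f"
      unfolding substitute_def using f(1)
      by (intro free_eval_substitution[of "n * n" _ m])
        (auto simp: left_def right_def h intro!: free_algebra_mult)
    also have "(\<lambda>k. free_eval x (right (k div n) * left (k mod n))) = b"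
      by (simp add: fun_eq_iff b_def left_def right_def h free_eval_mult[of _ m])
    finally have "free_eval x (substitute f) = free_eval b f" .
    then have subst_f: "substitute f \<in> free.ideal_of (free_algebra m) hull R"
      unfolding hull_R using f substitute_in_free_algebra by simp
    have "sandwich s t r \<in> J" if "r \<in> R" "s < n" "t < n" for r s t
      using that by (intro relations_in_J[of s t]) (simp_all add: relations_def)
    then have "sandwich 0 0 (substitute f) \<in> J"
      by (rule sandwich_preserves_ideal[OF ideal _ R(2) subst_f n n])
    then have "sandwich 0 0 (substitute f) - (sandwich 0 0 (substitute f) - f) \<in> J"
      by (intro free.subspace_diff[OF subspace_J] sandwich_substitute f)
    then show "f \<in> J"
      by simp
  qed
  have "subalgebra hull (b ` {..<?M}) = peirce e"
  proof
    have "b k \<in> peirce e" if "k < ?M" for k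
    proof -
      have "b k = e * b k * e"
        using index_less[OF that] by (simp add: b_def corner)
      then show ?thesis
        unfolding peirce_def by blast
    qed
    then have "b ` {..<?M} \<subseteq> peirce e"
      by blast
    then show "subalgebra hull (b ` {..<?M}) \<subseteq> peirce e"
      by (rule hull_minimal) (rule subalgebra_peirce[OF e])
    have "e * y * e \<in> subalgebra hull (b ` {..<?M})" for y
    proof -
      have "e * y * e = free_eval b (sandwich 0 0 (h y))"
        by (simp add: eval_sandwich h n pq0)
      then show ?thesis
        unfolding subalgebra_hull_eq_free_eval
        using sandwich_in_free_algebra[OF n n] by (rule image_eqI)
    qed
    then show "peirce e \<subseteq> subalgebra hull (b ` {..<?M})"
      unfolding peirce_def by blast
  qed
  moreover have "free.finitely_generated_ideal (free_algebra ?M) ?K"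
    unfolding free.finitely_generated_ideal_def
  proof (intro exI conjI)
    show "finite S" by fact
    show "S \<subseteq> free_algebra ?M" using \<open>S \<subseteq> ?K\<close> by auto
    show "free.ideal_of (free_algebra ?M) hull S = ?K"
      unfolding J_def[symmetric] by (rule equalityI) fact+
  qed
  ultimately show ?thesis
    unfolding finitely_presented_def by (intro exI conjI)
qed

end

theorem theorem2:
  fixes scale :: "'f::field \<Rightarrow> 'a::ring \<Rightarrow> 'a"
    and e :: 'a
  assumes "assoc_algebra scale"
    and "assoc_algebra.finitely_presented scale UNIV"
    and "e * e = e"
    and "module.span scale {a * e * b | a b. True} = UNIV"
    and "module.span scale {a * b - a * e * b | a b. True} = UNIV"
  shows "assoc_algebra.finitely_presented scale (peirce e)"
  by (rule assoc_algebra.peirce_finitely_presented) (use assms in auto)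

end
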